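(* The worst-case time complexity of Algorithm 1 (semigroup-based IFO verification) and of Algorithm 2 (observer-based IFO verification) for partially ordered automata with $n$ states is $O^*\big(2^{n(n+1)/2}\big)$, and this result is tight; that is, for every $n\ge 1$ there is a partially ordered automaton with $n$ states (and suitable sets of secret and nonsecret pairs) on which Algorithm 1 needs at least $2^{n(n+1)/2}$ steps and on which Algorithm 2 needs at least $2^{n(n+1)/2}$ steps.
   Context: An automaton is a triple $\mathcal{A}=(Q,\Sigma,\delta)$ with a finite state set $Q$, a finite nonempty alphabet $\Sigma$ (events), and $\delta\colon Q\times\Sigma\to 2^Q$, extended to $2^Q\times\Sigma^*$ as usual. It is partially ordered if the reachability relation $p\le q$ iff $q\in\delta(p,w)$ for some $w\in\Sigma^*$ is a partial order (equivalently, the only cycles are self-loops). $\mathcal{A}[I,F]$ denotes the NFA that is a copy of $\mathcal{A}$ with initial states $I$ and final states $F$ (a singleton is written as its element). $\Sigma_o\subseteq\Sigma$ is the set of observable events and $P\colon\Sigma^*\to\Sigma_o^*$ is the morphism erasing the unobservable events. IFO: $\mathcal{A}$ is initial-and-final-state opaque (IFO) with respect to sets of secret and nonsecret pairs of states $Q_S,Q_{NS}\subseteq Q\times Q$ and $P$ if for all $(s,t)\in Q_S$ and all $w$ with $t\in\delta(s,w)$ there are $(s',t')\in Q_{NS}$ and $w'$ with $t'\in\delta(s',w')$ and $P(w)=P(w')$. For Algorithm 2, a set $S\subseteq Q\times Q$ of pairs is represented in clustered form as a subset of $Q\times 2^Q$ with at most one pair $(s,T)$ for each $s$, where $T=\{f\mid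 (s,f)\in S\}$. Projected automaton: $P(\mathcal{A})$ is the automaton over $\Sigma_o$ with the same states as $\mathcal{A}$, obtained by replacing each transition $(q,a,r)$ by $(q,P(a),r)$ and eliminating $\varepsilon$-transitions. The observer of an NFA is the reachable part of the DFA obtained from its projected automaton by the standard subset construction. The disjoint union of automata makes their state sets pairwise disjoint by renaming and takes the component-wise union (of states, transitions, initial states and final states). Semigroup: for an $n$-state automaton, each string $w$ defines the $n\times n$ binary matrix $(w_{ij})$ with $w_{ij}=1$ iff $j\in\delta(i,w)$ (the empty string defines the identity matrix). $\mathcal{B}_{\mathcal{A}}$ is the semigroup, under boolean matrix multiplication (addition replaced by maximum), of all matrices defined by strings. Algorithm 1 (input: $\mathcal{A}$, $Q_S,Q_{NS}\subseteq Q\times Q$, $\Sigma_o$): construct $P(\mathcal{A})$; compute the elements of $\mathcal{B}_{P(\mathcal{A})}$ one by one; for every newly generated element $(w_{ij})$ and every $(s,f)\in Q_S$, if $w_{sf}=1$ and there is no $(s',f')\in Q_{NS}$ with $w_{s'f'}=1$, return false; after all elements have been processed, return true. Algorithm 2 (input: $\mathcal{A}$, clustered $Q_S,Q_{NS}\subseteq Q\times 2^Q$, $\Sigma_o$): let $\mathcal{A}_S$ be the disjoint union of $\mathcal{A}[s,T]$ for $(s,T)\in Q_S$; let $\mathcal{A}_{NS}$ be the disjoint union of $\mathcal{A}[s,T]$ for $(s,T)\in Q_{NS}$; compute the observer $\mathcal{A}_{NS}^{obs}$ of $\mathcal{A}_{NS}$; decide whether $P(L_m(\mathcal{A}_S))\subseteq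 P(L_m(\mathcal{A}_{NS}))$ by testing emptiness of the product of (the projection of) $\mathcal{A}_S$ with the complement of $\mathcal{A}_{NS}^{obs}$, and return the answer. Time is measured as a function of the number $n$ of states of $\mathcal{A}$: for Algorithm 1, each generated semigroup element is checked by one scan of its $n^2$ entries, giving time $O(|\mathcal{B}_{P(\mathcal{A})}|\cdot n^2)$; for Algorithm 2, time is counted by the number of states of the constructed automata (the observer and the product). Each semigroup element, resp. each observer state, costs at least one step. $O^*(g(n))=O(g(n)\,\mathrm{poly}(n))$. *)

theory Defs
  imports Complex_Main "HOL-Library.Landau_Symbols" "HOL-Computational_Algebra.Polynomial"
begin

section \<open>Automata\<close>

record ('q, 'e) automaton =
  states :: "'q set"
  events :: "'e set"
  delta :: "'q \<Rightarrow> 'e \<Rightarrow> 'q set"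

record ('q, 'e) nfa = "('q, 'e) automaton" +
  initial :: "'q set"
  final :: "'q set"

definition wf_automaton :: "('q, 'e, 'm) automaton_scheme \<Rightarrow> bool" where
  "wf_automaton A \<longleftrightarrow> finite (states A) \<and> finite (events A) \<and> events A \<noteq> {} \<and>
     (\<forall>q\<in>states A. \<forall>a\<in>events A. delta A q a \<subseteq> states A)"

fun delta_hat :: "('q, 'e, 'm) automaton_scheme \<Rightarrow> 'q set \<Rightarrow> 'e list \<Rightarrow> 'q set" where
  "delta_hat A X [] = X"
| "delta_hat A X (a # w) = delta_hat A (\<Union>q\<in>X. delta A q a) w"

definition reachability :: "('q, 'e, 'm) automaton_scheme \<Rightarrow> ('q \<times> 'q) set" where
  "reachability A =
     {(p, q). p \<in> states A \<and> q \<in> states A \<and> (\<exists>w\<in>lists (events A). q \<in> delta_hat A {p} w)}"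

definition partially_ordered :: "('q, 'e, 'm) automaton_scheme \<Rightarrow> bool" where
  "partially_ordered A \<longleftrightarrow> partial_order_on (states A) (reachability A)"

definition nfa_of :: "('q, 'e) automaton \<Rightarrow> 'q set \<Rightarrow> 'q set \<Rightarrow> ('q, 'e) nfa" where
  "nfa_of A I F = \<lparr>states = states A, events = events A, delta = delta A, initial = I, final = F\<rparr>"

definition marked_language :: "('q, 'e, 'm) nfa_scheme \<Rightarrow> 'e list set" where
  "marked_language N = {w \<in> lists (events N). delta_hat N (initial N) w \<inter> final N \<noteq> {}}"


section \<open>Projection and observer\<close>

definition unobs_reach :: "'e set \<Rightarrow> ('q, 'e, 'm) automaton_scheme \<Rightarrow> ('q \<times> 'q) set" where
  "unobs_reach So A = {(q, r). \<exists>a \<in> events A - So. r \<in> delta A q a}\<^sup>*"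

definition project :: "'e set \<Rightarrow> ('q, 'e, 'm) automaton_scheme \<Rightarrow> ('q, 'e, 'm) automaton_scheme" where
  "project So A = A\<lparr>events := So,
     delta := \<lambda>q a. unobs_reach So A `` (\<Union>p \<in> unobs_reach So A `` {q}. delta A p a)\<rparr>"

text \<open>For an NFA, eliminating the \<open>\<epsilon>\<close>-transitions also closes the initial states under
  unobservable moves; otherwise the marked language would not be preserved (see
  \<open>marked_language_project_nfa\<close>).\<close>

definition project_nfa :: "'e set \<Rightarrow> ('q, 'e, 'm) nfa_scheme \<Rightarrow> ('q, 'e, 'm) nfa_scheme" where
  "project_nfa So N = (project So N)\<lparr>initial := unobs_reach So N `` initial N\<rparr>"

definition determinize :: "('q, 'e) nfa \<Rightarrow> ('q set, 'e) nfa" where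
  "determinize N = \<lparr>states = Pow (states N), events = events N,
     delta = (\<lambda>X a. {\<Union>q\<in>X. delta N q a}),
     initial = {initial N}, final = {X \<in> Pow (states N). X \<inter> final N \<noteq> {}}\<rparr>"

definition reachable_part :: "('q, 'e) nfa \<Rightarrow> ('q, 'e) nfa" where
  "reachable_part N =
     (let R = \<Union>w\<in>lists (events N). delta_hat N (initial N) w
      in N\<lparr>states := states N \<inter> R, final := final N \<inter> R\<rparr>)"

definition observer :: "'e set \<Rightarrow> ('q, 'e) nfa \<Rightarrow> ('q set, 'e) nfa" where
  "observer So N = reachable_part (determinize (project_nfa So N))"

definition complement_dfa :: "('q, 'e) nfa \<Rightarrow> ('q, 'e) nfa" where
  "complement_dfa N = N\<lparr>final := states N - final N\<rparr>"

definition product_nfa :: "('p, 'e) nfa \<Rightarrow> ('q, 'e) nfa \<Rightarrow> ('p \<times> 'q, 'e) nfa" where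
  "product_nfa M N = \<lparr>states = states M \<times> states N, events = events M \<inter> events N,
     delta = (\<lambda>(p, q) a. delta M p a \<times> delta N q a),
     initial = initial M \<times> initial N, final = final M \<times> final N\<rparr>"

text \<open>The alphabet is passed explicitly so that the union of an empty family still has one.\<close>

definition disjoint_union :: "'e set \<Rightarrow> 'i set \<Rightarrow> ('i \<Rightarrow> ('q, 'e) nfa) \<Rightarrow> ('i \<times> 'q, 'e) nfa" where
  "disjoint_union \<Sigma> I N = \<lparr>states = Sigma I (\<lambda>i. states (N i)), events = \<Sigma>,
     delta = (\<lambda>(i, q) a. {i} \<times> delta (N i) q a),
     initial = Sigma I (\<lambda>i. initial (N i)), final = Sigma I (\<lambda>i. final (N i))\<rparr>"


section \<open>The semigroup of boolean matrices\<close>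

text \<open>A binary matrix indexed by the states is a boolean-valued function that is \<open>False\<close> outside
  the state set, so that equality of functions is equality of matrices.\<close>

type_synonym 'q bmat = "'q \<Rightarrow> 'q \<Rightarrow> bool"

definition word_matrix :: "('q, 'e, 'm) automaton_scheme \<Rightarrow> 'e list \<Rightarrow> 'q bmat" where
  "word_matrix A w = (\<lambda>i j. i \<in> states A \<and> j \<in> states A \<and> j \<in> delta_hat A {i} w)"

definition bmat_mult :: "'q set \<Rightarrow> 'q bmat \<Rightarrow> 'q bmat \<Rightarrow> 'q bmat" where
  "bmat_mult Q M N = (\<lambda>i j. \<exists>k\<in>Q. M i k \<and> N k j)"

definition matrix_semigroup :: "('q, 'e, 'm) automaton_scheme \<Rightarrow> 'q bmat set" where
  "matrix_semigroup A = word_matrix A ` lists (events A)"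


section \<open>The two algorithms\<close>

definition ifo_input ::
  "('q, 'e) automaton \<Rightarrow> 'e set \<Rightarrow> ('q \<times> 'q) set \<Rightarrow> ('q \<times> 'q) set \<Rightarrow> bool" where
  "ifo_input A So QS QNS \<longleftrightarrow> wf_automaton A \<and> So \<subseteq> events A \<and>
     QS \<subseteq> states A \<times> states A \<and> QNS \<subseteq> states A \<times> states A"

text \<open>The order in which the semigroup elements are generated is left open: the algorithm runs on
  any enumeration of them without repetition.\<close>

definition generation_order :: "('q, 'e) automaton \<Rightarrow> 'e set \<Rightarrow> 'q bmat list \<Rightarrow> bool" where
  "generation_order A So Ms \<longleftrightarrow> distinct Ms \<and> set Ms = matrix_semigroup (project So A)"

definition violates :: "('q \<times> 'q) set \<Rightarrow> ('q \<times> 'q) set \<Rightarrow> 'q bmat \<Rightarrow> bool" where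
  "violates QS QNS M \<longleftrightarrow> (\<exists>(s, f)\<in>QS. M s f \<and> \<not> (\<exists>(s', f')\<in>QNS. M s' f'))"

text \<open>Both algorithms return the answer together with the number of steps. Here \<open>c M\<close> is the number
  of steps spent on generating and checking \<open>M\<close>.\<close>

fun algorithm1 ::
  "('q bmat \<Rightarrow> nat) \<Rightarrow> ('q \<times> 'q) set \<Rightarrow> ('q \<times> 'q) set \<Rightarrow> 'q bmat list \<Rightarrow> bool \<times> nat" where
  "algorithm1 c QS QNS [] = (True, 0)"
| "algorithm1 c QS QNS (M # Ms) =
     (if violates QS QNS M then (False, c M)
      else (let (b, t) = algorithm1 c QS QNS Ms in (b, c M + t)))"

definition cluster :: "('q \<times> 'q) set \<Rightarrow> ('q \<times> 'q set) set" where
  "cluster S = (\<lambda>s. (s, {f. (s, f) \<in> S})) ` Domain S"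

definition cluster_nfa ::
  "('q, 'e) automaton \<Rightarrow> ('q \<times> 'q set) set \<Rightarrow> (('q \<times> 'q set) \<times> 'q, 'e) nfa" where
  "cluster_nfa A C = disjoint_union (events A) C (\<lambda>(s, T). nfa_of A {s} T)"

definition algorithm2 ::
  "('q, 'e) automaton \<Rightarrow> 'e set \<Rightarrow> ('q \<times> 'q set) set \<Rightarrow> ('q \<times> 'q set) set \<Rightarrow> bool \<times> nat" where
  "algorithm2 A So CS CNS =
     (let obs = observer So (cluster_nfa A CNS);
          prd = product_nfa (project_nfa So (cluster_nfa A CS)) (complement_dfa obs)
      in (marked_language prd = {}, card (states obs) + card (states prd)))"

definition O_star :: "(nat \<Rightarrow> real) \<Rightarrow> (nat \<Rightarrow> real) set" where
  "O_star g = {f. \<exists>p :: real poly. f \<in> O(\<lambda>n. g n * poly p (real n))}"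


section \<open>Sanity checks\<close>

lemma delta_hat_append: "delta_hat A X (u @ v) = delta_hat A (delta_hat A X u) v"
  by (induction u arbitrary: X) auto

lemma delta_hat_UN: "delta_hat A X w = (\<Union>q\<in>X. delta_hat A {q} w)"
proof (induction w arbitrary: X)
  case Nil
  then show ?case by simp
next
  case (Cons a w)
  have "delta_hat A X (a # w) = (\<Union>q\<in>(\<Union>q\<in>X. delta A q a). delta_hat A {q} w)"
    using Cons[of "\<Union>q\<in>X. delta A q a"] by simp
  also have "\<dots> = (\<Union>q\<in>X. \<Union>r\<in>delta A q a. delta_hat A {r} w)" by blast
  also have "\<dots> = (\<Union>q\<in>X. delta_hat A {q} (a # w))"
  proof (rule SUP_cong[OF refl])
    fix q show "(\<Union>r\<in>delta A q a. delta_hat A {r} w) = delta_hat A {q} (a # w)"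
      using Cons[of "delta A q a"] by simp
  qed
  finally show ?case .
qed

lemma delta_hat_closed:
  assumes "\<forall>q\<in>states A. \<forall>a\<in>events A. delta A q a \<subseteq> states A"
    and "X \<subseteq> states A" and "w \<in> lists (events A)"
  shows "delta_hat A X w \<subseteq> states A"
  using assms(2,3)
proof (induction w arbitrary: X)
  case (Cons a w)
  have "(\<Union>q\<in>X. delta A q a) \<subseteq> states A" using Cons.prems assms(1) by auto
  then show ?case using Cons.IH[of "\<Union>q\<in>X. delta A q a"] Cons.prems by auto
qed simp

lemma word_matrix_append:
  assumes "wf_automaton A" "u \<in> lists (events A)"
  shows "word_matrix A (u @ v) = bmat_mult (states A) (word_matrix A u) (word_matrix A v)"
proof (intro ext)
  fix i j
  show "word_matrix A (u @ v) i j = bmat_mult (states A) (word_matrix A u) (word_matrix A v) i j"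
  proof (cases "i \<in> states A")
    case True
    then have "delta_hat A {i} u \<subseteq> states A"
      using assms by (intro delta_hat_closed) (auto simp: wf_automaton_def)
    moreover have "delta_hat A (delta_hat A {i} u) v = (\<Union>k\<in>delta_hat A {i} u. delta_hat A {k} v)"
      by (rule delta_hat_UN)
    ultimately show ?thesis
      using True by (auto simp: word_matrix_def bmat_mult_def delta_hat_append)
  qed (simp add: word_matrix_def bmat_mult_def)
qed

lemma generation_order_exists:
  assumes "wf_automaton A"
  shows "\<exists>Ms. generation_order A So Ms"
proof -
  let ?Q = "states A"
  have "matrix_semigroup (project So A) \<subseteq> (\<lambda>R i j. (i, j) \<in> R) ` Pow (?Q \<times> ?Q)"
  proof
    fix M assume "M \<in> matrix_semigroup (project So A)"
    then have "{(i, j). M i j} \<in> Pow (?Q \<times> ?Q)"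
      by (auto simp: matrix_semigroup_def word_matrix_def project_def)
    moreover have "M = (\<lambda>i j. (i, j) \<in> {(i, j). M i j})" by simp
    ultimately show "M \<in> (\<lambda>R i j. (i, j) \<in> R) ` Pow (?Q \<times> ?Q)" by blast
  qed
  moreover have "finite ?Q" using assms by (simp add: wf_automaton_def)
  ultimately have "finite (matrix_semigroup (project So A))"
    by (meson finite_Pow_iff finite_SigmaI finite_imageI finite_subset)
  then show ?thesis unfolding generation_order_def using finite_distinct_list by metis
qed

lemma delta_hat_mono: "X \<subseteq> Y \<Longrightarrow> delta_hat A X w \<subseteq> delta_hat A Y w"
  by (subst (1 2) delta_hat_UN) blast

lemma unobs_reach_word:
  assumes "(p, q) \<in> unobs_reach So N"
  shows "\<exists>w\<in>lists (events N - So). q \<in> delta_hat N {p} w"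
  using assms unfolding unobs_reach_def
proof (induction rule: rtrancl_induct)
  case base
  have "p \<in> delta_hat N {p} []" by simp
  then show ?case by blast
next
  case (step q r)
  then obtain w a where w: "w \<in> lists (events N - So)" "q \<in> delta_hat N {p} w"
    and a: "a \<in> events N - So" "r \<in> delta N q a" by blast
  have "r \<in> delta_hat N {p} (w @ [a])" using w a by (auto simp: delta_hat_append)
  moreover have "w @ [a] \<in> lists (events N - So)" using w a by auto
  ultimately show ?case by blast
qed

lemma delta_hat_in_project:
  assumes "w \<in> lists (events N)"
  shows "delta_hat N X w \<subseteq>
    delta_hat (project So N) (unobs_reach So N `` X) (filter (\<lambda>a. a \<in> So) w)"
  using assms
proof (induction w arbitrary: X)
  case Nil
  then show ?case by (auto simp: unobs_reach_def)
next
  case (Cons a w)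
  let ?U = "unobs_reach So N" and ?D = "\<Union>q\<in>X. delta N q a"
  have IH: "delta_hat N ?D w \<subseteq> delta_hat (project So N) (?U `` ?D) (filter (\<lambda>a. a \<in> So) w)"
    using Cons by auto
  have a: "a \<in> events N" using Cons by simp
  show ?case
  proof (cases "a \<in> So")
    case True
    have "?U `` ?D \<subseteq> (\<Union>q\<in>?U `` X. delta (project So N) q a)"
      unfolding project_def by (auto simp: unobs_reach_def)
    from delta_hat_mono[OF this] show ?thesis using IH True by auto
  next
    case False
    have "?U `` ?D \<subseteq> ?U `` X"
    proof
      fix r assume "r \<in> ?U `` ?D"
      then obtain q p where qp: "q \<in> X" "p \<in> delta N q a" "(p, r) \<in> ?U" by blast
      then have "(q, p) \<in> {(q, r). \<exists>a \<in> events N - So. r \<in> delta N q a}"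
        using False a by blast
      then have "(q, r) \<in> ?U"
        using qp(3) unfolding unobs_reach_def by (rule converse_rtrancl_into_rtrancl)
      then show "r \<in> ?U `` X" using qp(1) by blast
    qed
    from delta_hat_mono[OF this] show ?thesis using IH False by auto
  qed
qed

lemma delta_hat_from_project:
  assumes "So \<subseteq> events N" "u \<in> lists So"
    and "q \<in> delta_hat (project So N) (unobs_reach So N `` X) u"
  shows "\<exists>w\<in>lists (events N). filter (\<lambda>a. a \<in> So) w = u \<and> q \<in> delta_hat N X w"
  using assms(2,3)
proof (induction u arbitrary: q rule: rev_induct)
  case Nil
  then obtain p where p: "p \<in> X" "(p, q) \<in> unobs_reach So N" by auto
  then obtain w where w: "w \<in> lists (events N - So)" "q \<in> delta_hat N {p} w"
    using unobs_reach_word by metis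
  have "q \<in> delta_hat N X w" using delta_hat_mono[of "{p}" X N w] w p by auto
  moreover have "w \<in> lists (events N)" "filter (\<lambda>a. a \<in> So) w = []"
    using w by (auto simp: filter_empty_conv)
  ultimately show ?case by blast
next
  case (snoc a u)
  then obtain r where r: "r \<in> delta_hat (project So N) (unobs_reach So N `` X) u"
    and q: "q \<in> delta (project So N) r a" by (auto simp: delta_hat_append)
  from q obtain p p' where p: "(r, p) \<in> unobs_reach So N" "p' \<in> delta N p a"
    "(p', q) \<in> unobs_reach So N" by (auto simp: project_def)
  obtain w where w: "w \<in> lists (events N)" "filter (\<lambda>a. a \<in> So) w = u" "r \<in> delta_hat N X w"
    using snoc r by auto
  obtain v where v: "v \<in> lists (events N - So)" "p \<in> delta_hat N {r} v"
    using unobs_reach_word p by metis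
  obtain v' where v': "v' \<in> lists (events N - So)" "q \<in> delta_hat N {p'} v'"
    using unobs_reach_word p by metis
  have 1: "p \<in> delta_hat N X (w @ v)"
    using delta_hat_mono[of "{r}" "delta_hat N X w" N v] w v by (auto simp: delta_hat_append)
  have 2: "p' \<in> delta_hat N X ((w @ v) @ [a])"
    using 1 p by (subst delta_hat_append) auto
  have "q \<in> delta_hat N X (((w @ v) @ [a]) @ v')"
    using delta_hat_mono[of "{p'}" "delta_hat N X ((w @ v) @ [a])" N v'] 2 v'
    by (subst delta_hat_append) auto
  moreover have "filter (\<lambda>a. a \<in> So) v = []" "filter (\<lambda>a. a \<in> So) v' = []"
    using v v' by (auto simp: filter_empty_conv)
  then have "filter (\<lambda>a. a \<in> So) (((w @ v) @ [a]) @ v') = u @ [a]"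
    using w snoc.prems by simp
  moreover have "((w @ v) @ [a]) @ v' \<in> lists (events N)"
    using w v v' snoc.prems assms(1) by auto
  ultimately show ?case by blast
qed

lemma delta_hat_initial_update [simp]: "delta_hat (N\<lparr>initial := I\<rparr>) X w = delta_hat N X w"
  by (induction w arbitrary: X) auto

lemma marked_language_project_nfa:
  assumes "So \<subseteq> events N"
  shows "marked_language (project_nfa So N) = filter (\<lambda>a. a \<in> So) ` marked_language N"
proof -
  let ?P = "filter (\<lambda>a. a \<in> So)"
  have [simp]: "events (project So N) = So" "final (project So N) = final N"
    by (simp_all add: project_def)
  show ?thesis
  proof (intro equalityI subsetI)
    fix u assume "u \<in> marked_language (project_nfa So N)"
    then obtain q where "u \<in> lists So" "q \<in> final N"
      "q \<in> delta_hat (project So N) (unobs_reach So N `` initial N) u"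
      by (auto simp: marked_language_def project_nfa_def)
    with delta_hat_from_project[OF assms] show "u \<in> ?P ` marked_language N"
      unfolding marked_language_def by blast
  next
    fix u assume "u \<in> ?P ` marked_language N"
    then obtain w where w: "w \<in> lists (events N)" "delta_hat N (initial N) w \<inter> final N \<noteq> {}"
      "u = ?P w" by (auto simp: marked_language_def)
    with delta_hat_in_project[OF w(1), of "initial N" So]
    show "u \<in> marked_language (project_nfa So N)"
      by (auto simp: marked_language_def project_nfa_def)
  qed
qed

end

theory Submission
  imports Defs
begin

text \<open>A matrix of the projected automaton is a subset of the reachability relation, and so,
  after forgetting the redundant second component of the clusters, is an observer state. A partial
  order on \<open>n\<close> elements has at most \<open>n (n + 1) / 2\<close> pairs, which gives the upper bounds.
  For tightness, take the fully observed automaton on \<open>0, \<dots>, n - 1\<close> with one letter for each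
  subset of the order \<open>\<le>\<close>: already its one-letter words generate all these matrices and all
  these observer states.\<close>

section \<open>Reachability\<close>

lemma reachabilityI:
  assumes "wf_automaton A" "p \<in> states A" "w \<in> lists (events A)" "q \<in> delta_hat A {p} w"
  shows "(p, q) \<in> reachability A"
proof -
  have "delta_hat A {p} w \<subseteq> states A"
    using assms by (intro delta_hat_closed) (auto simp: wf_automaton_def)
  then show ?thesis using assms by (auto simp: reachability_def)
qed

text \<open>Inclusion-exclusion on \<open>r\<close> and its converse: they have equal size, by
  antisymmetry they meet only on the diagonal, and their union lies in \<open>Q \<times> Q\<close>.
  Hence twice \<open>card r\<close> is at most n^2 + n, where n is \<open>card Q\<close>.\<close>

lemma partial_order_on_card_le:
  assumes "finite Q" "r \<subseteq> Q \<times> Q" "antisym r"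
  shows "card r \<le> card Q * (card Q + 1) div 2"
proof -
  have fin: "finite r" using assms finite_subset by blast
  have "r \<inter> r\<inverse> \<subseteq> (\<lambda>x. (x, x)) ` Q"
    using assms by (auto simp: antisym_def)
  then have "card (r \<inter> r\<inverse>) \<le> card Q"
    using assms(1) by (meson card_image_le card_mono finite_imageI le_trans)
  moreover have "r \<union> r\<inverse> \<subseteq> Q \<times> Q" using assms(2) by auto
  then have "card (r \<union> r\<inverse>) \<le> card Q * card Q"
    using assms(1) card_mono[of "Q \<times> Q" "r \<union> r\<inverse>"] by (simp add: card_cartesian_product)
  moreover have "card r + card (r\<inverse>) = card (r \<union> r\<inverse>) + card (r \<inter> r\<inverse>)"
    using fin by (intro card_Un_Int) auto
  ultimately show ?thesis by simp
qed

lemma partially_ordered_card_reachability: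
  assumes "wf_automaton A" "partially_ordered A"
  shows "finite (reachability A)"
    and "card (reachability A) \<le> card (states A) * (card (states A) + 1) div 2"
proof -
  have sub: "reachability A \<subseteq> states A \<times> states A" by (auto simp: reachability_def)
  have fin: "finite (states A)" using assms by (simp add: wf_automaton_def)
  show "finite (reachability A)" using sub fin finite_subset by blast
  show "card (reachability A) \<le> card (states A) * (card (states A) + 1) div 2"
    using assms(2) sub fin
    by (intro partial_order_on_card_le) (auto simp: partially_ordered_def partial_order_on_def)
qed

text \<open>Serves both counts below: \<open>R\<close> becomes the reachability relation and
  \<open>f\<close> encodes a matrix or an observer state as a set of pairs.\<close>

lemma card_inj_image_Pow_le:
  assumes "f ` S \<subseteq> Pow R" "inj_on f S" "finite R" "card R \<le> m"
  shows "card S \<le> 2 ^ m"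
proof -
  have "card S \<le> card (Pow R)" using assms by (intro card_inj_on_le) auto
  also have "\<dots> \<le> 2 ^ m" using assms by (simp add: card_Pow)
  finally show ?thesis .
qed

lemma Image_unobs_reach_superset: "X \<subseteq> unobs_reach So A `` X"
  by (auto simp: unobs_reach_def)


section \<open>Algorithm 1\<close>

text \<open>Closing the start set under unobservable moves only enlarges what is reached, so
  \<open>delta_hat_from_project\<close> applies and lifts the observable word to a word of
  \<open>A\<close> from \<open>i\<close> to \<open>j\<close>.\<close>

lemma word_matrix_project_reachability:
  assumes "wf_automaton A" "So \<subseteq> events A" "u \<in> lists So" "word_matrix (project So A) u i j"
  shows "(i, j) \<in> reachability A"
proof -
  have i: "i \<in> states A" and "j \<in> delta_hat (project So A) {i} u"
    using assms(4) by (auto simp: word_matrix_def project_def)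
  then have "j \<in> delta_hat (project So A) (unobs_reach So A `` {i}) u"
    using delta_hat_mono[OF Image_unobs_reach_superset[of "{i}" So A]] by blast
  from delta_hat_from_project[OF assms(2,3) this] show ?thesis
    using reachabilityI[OF assms(1) i] by blast
qed

text \<open>A matrix is encoded by the set of its true entries, which determines it.\<close>

lemma card_matrix_semigroup_le:
  assumes "wf_automaton A" "So \<subseteq> events A" "partially_ordered A"
  shows "card (matrix_semigroup (project So A)) \<le>
    2 ^ (card (states A) * (card (states A) + 1) div 2)"
proof (rule card_inj_image_Pow_le)
  show "(\<lambda>M. {(i, j). M i j}) ` matrix_semigroup (project So A) \<subseteq> Pow (reachability A)"
    using word_matrix_project_reachability[OF assms(1,2)]
    by (auto simp: matrix_semigroup_def project_def)
  show "inj_on (\<lambda>M. {(i, j). M i j}) (matrix_semigroup (project So A))"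
    by (auto simp: inj_on_def fun_eq_iff set_eq_iff)
qed (use partially_ordered_card_reachability[OF assms(1,3)] in auto)

text \<open>An early exit only drops the cost of later elements, so the bound does not depend on the
  answer.\<close>

lemma algorithm1_steps_le:
  assumes "\<And>M. M \<in> set Ms \<Longrightarrow> c M \<le> b"
  shows "snd (algorithm1 c QS QNS Ms) \<le> b * length Ms"
  using assms
proof (induction Ms)
  case (Cons M Ms)
  then have "snd (algorithm1 c QS QNS Ms) \<le> b * length Ms" "c M \<le> b" by auto
  then show ?case by (auto simp: case_prod_beta Let_def)
qed simp

text \<open>Without a violation there is no early exit, so every listed element is paid for.\<close>

lemma algorithm1_steps_ge:
  assumes "\<And>M. M \<in> set Ms \<Longrightarrow> \<not> violates QS QNS M" "\<And>M. M \<in> set Ms \<Longrightarrow> 1 \<le> c M"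
  shows "length Ms \<le> snd (algorithm1 c QS QNS Ms)"
  using assms
proof (induction Ms)
  case (Cons M Ms)
  then have "length Ms \<le> snd (algorithm1 c QS QNS Ms)" "1 \<le> c M" by auto
  then show ?case using Cons.prems(1) by (auto simp: case_prod_beta Let_def)
qed simp

lemma generation_order_length:
  assumes "generation_order A So Ms"
  shows "length Ms = card (matrix_semigroup (project So A))"
  using assms distinct_card by (fastforce simp: generation_order_def)

lemma algorithm1_upper_bound:
  assumes "ifo_input A So QS QNS" "partially_ordered A" "generation_order A So Ms"
    and "\<forall>M \<in> set Ms. c M \<le> K * card (states A) ^ 2"
  shows "snd (algorithm1 c QS QNS Ms) \<le>
    K * card (states A) ^ 2 * 2 ^ (card (states A) * (card (states A) + 1) div 2)"
proof -
  have "length Ms \<le> 2 ^ (card (states A) * (card (states A) + 1) div 2)"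
    using assms card_matrix_semigroup_le[of A So] generation_order_length[of A So Ms]
    by (simp add: ifo_input_def)
  then have "K * card (states A) ^ 2 * length Ms \<le>
      K * card (states A) ^ 2 * 2 ^ (card (states A) * (card (states A) + 1) div 2)"
    by (rule mult_le_mono2)
  with algorithm1_steps_le[of Ms c "K * card (states A) ^ 2" QS QNS] assms(4)
  show ?thesis by (meson le_trans)
qed


section \<open>Algorithm 2\<close>

text \<open>The DFA is encoded as an NFA with singleton successor sets; running it from one subset
  therefore keeps exactly one current subset.\<close>

lemma delta_hat_determinize: "delta_hat (determinize N) {X} w = {delta_hat N X w}"
  by (induction w arbitrary: X) (auto simp: determinize_def)

lemma states_observer:
  "states (observer So N) =
    Pow (states N) \<inter> delta_hat (project So N) (unobs_reach So N `` initial N) ` lists So"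
proof -
  let ?D = "determinize (project_nfa So N)"
  have D: "initial ?D = {unobs_reach So N `` initial N}" "states ?D = Pow (states N)"
    "events ?D = So"
    by (simp_all add: determinize_def project_nfa_def project_def)
  have "delta_hat ?D (initial ?D) w =
      {delta_hat (project So N) (unobs_reach So N `` initial N) w}" for w
    unfolding D delta_hat_determinize by (simp add: project_nfa_def)
  then show ?thesis
    by (simp add: observer_def reachable_part_def Let_def D(2,3) UNION_singleton_eq_range)
qed

text \<open>A run never leaves the copy in which it starts, so the tag \<open>i\<close> is carried
  along unchanged and the second component moves as in \<open>A\<close>.\<close>

lemma delta_hat_cluster_nfa:
  "delta_hat (cluster_nfa A C) X w = (\<Union>(i, p)\<in>X. {i} \<times> delta_hat A {p} w)"
proof (induction w arbitrary: X)
  case (Cons a w)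
  \<comment> \<open>Splits the successors into single states, the form in which the induction
    hypothesis describes runs.\<close>
  have step: "delta_hat A {p} (a # w) = (\<Union>q\<in>delta A p a. delta_hat A {q} w)" for p
    by (subst delta_hat.simps(2), subst delta_hat_UN) simp
  have delta: "delta (cluster_nfa A C) x a = {fst x} \<times> delta A (snd x) a" for x
    by (simp add: cluster_nfa_def disjoint_union_def nfa_of_def case_prod_beta)
  have "delta_hat (cluster_nfa A C) X (a # w) =
      (\<Union>(i, q)\<in>(\<Union>(i, p)\<in>X. {i} \<times> delta A p a). {i} \<times> delta_hat A {q} w)"
    by (simp add: Cons.IH delta case_prod_beta)
  also have "\<dots> = (\<Union>(i, p)\<in>X. {i} \<times> delta_hat A {p} (a # w))"
    unfolding step by blast
  finally show ?case .
qed auto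

lemma initial_cluster_nfa: "initial (cluster_nfa A C) = (\<lambda>(s, T). ((s, T), s)) ` C"
  by (force simp: cluster_nfa_def disjoint_union_def nfa_of_def)

lemma states_cluster_nfa: "states (cluster_nfa A C) = C \<times> states A"
  by (auto simp: cluster_nfa_def disjoint_union_def nfa_of_def)

lemma events_cluster_nfa: "events (cluster_nfa A C) = events A"
  by (auto simp: cluster_nfa_def disjoint_union_def)

text \<open>A member of an observer state is reached by a run from the initial state of its own
  copy. The tag is thus still a cluster, in which \<open>s\<close> determines \<open>T\<close>, and
  the run leads from \<open>s\<close> to \<open>q\<close> in \<open>A\<close>.\<close>

lemma observer_cluster_nfa_reachability:
  assumes "wf_automaton A" "So \<subseteq> events A" "QNS \<subseteq> states A \<times> states A"
    and "X \<in> states (observer So (cluster_nfa A (cluster QNS)))" "((s, T), q) \<in> X"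
  shows "T = {f. (s, f) \<in> QNS}" and "(s, q) \<in> reachability A"
proof -
  let ?N = "cluster_nfa A (cluster QNS)"
  obtain u where u: "u \<in> lists So"
    "((s, T), q) \<in> delta_hat (project So ?N) (unobs_reach So ?N `` initial ?N) u"
    using assms(4,5) by (auto simp: states_observer)
  obtain w where w: "w \<in> lists (events A)" "((s, T), q) \<in> delta_hat ?N (initial ?N) w"
    using delta_hat_from_project[OF _ u] assms(2) by (auto simp: events_cluster_nfa)
  then have sT: "(s, T) \<in> cluster QNS" and q: "q \<in> delta_hat A {s} w"
    by (auto simp: delta_hat_cluster_nfa initial_cluster_nfa)
  show "T = {f. (s, f) \<in> QNS}" using sT by (auto simp: cluster_def)
  have "s \<in> states A" using sT assms(3) by (auto simp: cluster_def)
  then show "(s, q) \<in> reachability A" using reachabilityI assms(1) w(1) q by metis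
qed

lemma card_states_observer_le:
  assumes "wf_automaton A" "So \<subseteq> events A" "QNS \<subseteq> states A \<times> states A" "partially_ordered A"
  shows "card (states (observer So (cluster_nfa A (cluster QNS)))) \<le>
    2 ^ (card (states A) * (card (states A) + 1) div 2)"
proof (rule card_inj_image_Pow_le)
  let ?S = "states (observer So (cluster_nfa A (cluster QNS)))"
  let ?f = "\<lambda>X. (\<lambda>((s, T :: 'a set), q). (s, q)) ` X"
  note reach = observer_cluster_nfa_reachability[OF assms(1-3)]
  show "?f ` ?S \<subseteq> Pow (reachability A)" using reach(2) by fastforce
  \<comment> \<open>Inverts \<open>?f\<close> on observer states by restoring from \<open>s\<close>
    the only possible \<open>T\<close>.\<close>
  let ?g = "\<lambda>Y. (\<lambda>(s, q). ((s, {f. (s, f) \<in> QNS}), q)) ` Y"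
  have "?g (?f X) = X" if "X \<in> ?S" for X
    using reach(1)[OF that] by (force simp: image_iff)
  then show "inj_on ?f ?S" by (rule inj_on_inverseI[where g = ?g])
qed (use partially_ordered_card_reachability[OF assms(1,4)] in auto)

lemma card_cluster_le:
  assumes "finite Q" "S \<subseteq> Q \<times> Q"
  shows "card (cluster S) \<le> card Q"
proof -
  have "Domain S \<subseteq> Q" using assms by auto
  then show ?thesis
    unfolding cluster_def using assms(1)
    by (meson card_image_le card_mono finite_subset le_trans)
qed

text \<open>The product is counted with its full state set: at most n copies of \<open>A\<close>
  with n states each, times the observer states. The summand 1 accounts for the observer
  itself.\<close>

lemma algorithm2_upper_bound:
  assumes "ifo_input A So QS QNS" "partially_ordered A"
  shows "snd (algorithm2 A So (cluster QS) (cluster QNS)) \<le>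
    (1 + card (states A) ^ 2) * 2 ^ (card (states A) * (card (states A) + 1) div 2)"
proof -
  let ?o = "card (states (observer So (cluster_nfa A (cluster QNS))))"
  have A: "wf_automaton A" "So \<subseteq> events A" "QS \<subseteq> states A \<times> states A"
    "QNS \<subseteq> states A \<times> states A" "finite (states A)"
    using assms(1) by (auto simp: ifo_input_def wf_automaton_def)
  have "snd (algorithm2 A So (cluster QS) (cluster QNS)) =
      (1 + card (cluster QS) * card (states A)) * ?o"
    by (simp add: algorithm2_def Let_def product_nfa_def complement_dfa_def project_nfa_def
        project_def[of So "cluster_nfa A (cluster QS)"] states_cluster_nfa
        card_cartesian_product)
  also have "\<dots> \<le> (1 + card (states A) * card (states A)) *
      2 ^ (card (states A) * (card (states A) + 1) div 2)"
    using card_cluster_le[OF A(5,3)] card_states_observer_le[OF A(1,2,4) assms(2)]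
    by (intro mult_le_mono add_le_mono) auto
  finally show ?thesis by (simp add: power2_eq_square)
qed


section \<open>The extremal automaton\<close>

text \<open>The total order on {0, ..., n-1}, a partial order attaining the bound of
  \<open>partial_order_on_card_le\<close>.\<close>

definition upper_pairs :: "nat \<Rightarrow> (nat \<times> nat) set" where
  "upper_pairs n = {(i, j). i \<le> j \<and> j < n}"

lemma card_upper_pairs: "card (upper_pairs n) = n * (n + 1) div 2"
proof -
  \<comment> \<open>Counting by the larger component: \<open>j\<close> has \<open>Suc j\<close>
    possible partners.\<close>
  have "upper_pairs n = prod.swap ` (SIGMA j:{..<n}. {..j})"
    by (auto simp: upper_pairs_def image_iff)
  then have "card (upper_pairs n) = card (SIGMA j:{..<n}. {..j})"
    by (simp add: card_image)
  also have "\<dots> = (\<Sum>j<n. Suc j)" by simp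
  also have "\<dots> = n * (n + 1) div 2" by (induction n) auto
  finally show ?thesis .
qed

lemma finite_upper_pairs: "finite (upper_pairs n)"
  by (rule finite_subset[of _ "{..<n} \<times> {..<n}"]) (auto simp: upper_pairs_def)

text \<open>Letter \<open>a\<close> acts as the relation \<open>h a\<close>. Naming relations by
  numbers keeps the event type \<open>nat\<close>; the alphabet size is the number of subsets of
  \<open>upper_pairs n\<close>, so \<open>h\<close> can be a bijection.\<close>

definition relation_automaton :: "nat \<Rightarrow> (nat \<Rightarrow> (nat \<times> nat) set) \<Rightarrow> (nat, nat) automaton" where
  "relation_automaton n h =
    \<lparr>states = {..<n}, events = {..<2 ^ (n * (n + 1) div 2)}, delta = \<lambda>q a. h a `` {q}\<rparr>"

lemma unobs_reach_all_observable: "unobs_reach (events A) A = Id"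
  by (simp add: unobs_reach_def)

lemma project_all_observable: "project (events A) A = A"
  by (simp add: project_def unobs_reach_all_observable)

context
  fixes n :: nat and h :: "nat \<Rightarrow> (nat \<times> nat) set"
  assumes h: "bij_betw h {..<2 ^ (n * (n + 1) div 2)} (Pow (upper_pairs n))"
begin

private abbreviation "A \<equiv> relation_automaton n h"

lemma relation_automaton_step: "a \<in> events A \<Longrightarrow> h a \<subseteq> upper_pairs n"
  using h by (auto simp: relation_automaton_def bij_betw_def)

lemma relation_automaton_letter:
  assumes "r \<subseteq> upper_pairs n"
  obtains a where "a \<in> events A" "h a = r"
proof -
  have "r \<in> h ` events A"
    using h assms by (auto simp: relation_automaton_def bij_betw_def)
  then show thesis using that by blast
qed

lemma wf_relation_automaton: "wf_automaton A"
  using relation_automaton_step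
  by (force simp: wf_automaton_def relation_automaton_def upper_pairs_def lessThan_empty_iff)

text \<open>Each letter acts as a subrelation of \<open>\<le>\<close>, so runs never descend. This
  yields antisymmetry of reachability.\<close>

lemma delta_hat_relation_automaton_ge:
  assumes "w \<in> lists (events A)" "q \<in> delta_hat A {p} w"
  shows "p \<le> q"
  using assms
proof (induction w arbitrary: q rule: rev_induct)
  case (snoc a w)
  then obtain r where "r \<in> delta_hat A {p} w" "(r, q) \<in> h a" "a \<in> events A"
    by (auto simp: delta_hat_append relation_automaton_def)
  then show ?case
    using snoc relation_automaton_step by (fastforce simp: upper_pairs_def)
qed simp

lemma partially_ordered_relation_automaton: "partially_ordered A"
proof -
  have "refl_on (states A) (reachability A)"
  proof (rule refl_onI)
    fix x assume "x \<in> states A"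
    then show "(x, x) \<in> reachability A"
      using reachabilityI[OF wf_relation_automaton, of x "[]" x] by simp
  qed
  moreover have "antisym (reachability A)"
    using delta_hat_relation_automaton_ge
    by (auto simp: antisym_def reachability_def intro: le_antisym)
  moreover have "trans (reachability A)"
  proof (rule transI)
    fix x y z assume "(x, y) \<in> reachability A" "(y, z) \<in> reachability A"
    then obtain u v where *: "x \<in> states A" "u \<in> lists (events A)" "y \<in> delta_hat A {x} u"
      "v \<in> lists (events A)" "z \<in> delta_hat A {y} v" by (auto simp: reachability_def)
    then have "z \<in> delta_hat A {x} (u @ v)"
      using delta_hat_mono[of "{y}" "delta_hat A {x} u" A v] by (auto simp: delta_hat_append)
    then show "(x, z) \<in> reachability A"
      using * by (intro reachabilityI[OF wf_relation_automaton, of _ "u @ v"]) auto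
  qed
  moreover have "reachability A \<subseteq> states A \<times> states A" by (auto simp: reachability_def)
  ultimately show ?thesis by (simp add: partially_ordered_def partial_order_on_def preorder_on_def)
qed

lemma card_matrix_semigroup_relation_automaton:
  "2 ^ (n * (n + 1) div 2) \<le> card (matrix_semigroup A)"
proof -
  let ?f = "\<lambda>r i j. (i, j) \<in> r"
  have "?f ` Pow (upper_pairs n) \<subseteq> matrix_semigroup A"
  proof (intro image_subsetI)
    fix r assume r: "r \<in> Pow (upper_pairs n)"
    then obtain a where a: "a \<in> events A" "h a = r" using relation_automaton_letter by blast
    \<comment> \<open>The matrix of a single letter is the relation that the letter names.\<close>
    have "?f r = word_matrix A [a]"
      using r a(2) by (auto simp: word_matrix_def relation_automaton_def fun_eq_iff upper_pairs_def)
    then show "?f r \<in> matrix_semigroup A" using a by (auto simp: matrix_semigroup_def)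
  qed
  moreover have "inj_on ?f (Pow (upper_pairs n))"
    by (auto simp: inj_on_def fun_eq_iff)
  \<comment> \<open>Monotonicity of \<open>card\<close> needs a finite superset; finiteness follows
    because the semigroup can be listed.\<close>
  moreover have "finite (matrix_semigroup A)"
    using generation_order_exists[OF wf_relation_automaton, of "events A"]
    unfolding generation_order_def project_all_observable by (metis List.finite_set)
  ultimately have "card (Pow (upper_pairs n)) \<le> card (matrix_semigroup A)"
    by (metis card_image card_mono)
  then show ?thesis by (simp add: card_Pow finite_upper_pairs card_upper_pairs)
qed

text \<open>Taking all pairs as nonsecret creates one copy of the automaton for each start state
  \<open>i\<close>. Together the copies record the image of every \<open>i\<close>, so an observer
  state stores a whole relation.\<close>

lemma card_observer_relation_automaton:
  defines "C \<equiv> cluster ({..<n} \<times> {..<n})"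
  shows "2 ^ (n * (n + 1) div 2) \<le> card (states (observer (events A) (cluster_nfa A C)))"
proof -
  let ?N = "cluster_nfa A C" and ?O = "observer (events A) (cluster_nfa A C)"
  let ?f = "\<lambda>r. (\<lambda>(i, j). ((i, {..<n}), j)) ` r"
  have C: "C = (\<lambda>s. (s, {..<n})) ` {..<n}"
    by (auto simp: C_def cluster_def image_iff)
  have proj: "project (events A) ?N = ?N" "unobs_reach (events A) ?N = Id"
    using project_all_observable[of ?N] unobs_reach_all_observable[of ?N]
    by (simp_all add: events_cluster_nfa)
  have "?f ` Pow (upper_pairs n) \<subseteq> states ?O"
  proof (intro image_subsetI)
    fix r assume r: "r \<in> Pow (upper_pairs n)"
    then obtain a where a: "a \<in> events A" "h a = r" using relation_automaton_letter by blast
    \<comment> \<open>Initially copy \<open>i\<close> sits at \<open>i\<close>; after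
      \<open>a\<close> it occupies \<open>h a\<close> applied to \<open>i\<close>, and the union
      over all copies is \<open>r\<close> with tags attached.\<close>
    have "?f r = delta_hat ?N (Id `` initial ?N) [a]"
      using r a(2) unfolding delta_hat_cluster_nfa initial_cluster_nfa C
      by (auto simp: relation_automaton_def upper_pairs_def image_iff)
    moreover have "?f r \<subseteq> states ?N"
      using r by (auto simp: states_cluster_nfa C relation_automaton_def upper_pairs_def)
    moreover have "[a] \<in> lists (events A)" using a(1) by simp
    ultimately show "?f r \<in> states ?O"
      unfolding states_observer proj by (intro IntI PowI image_eqI[of _ _ "[a]"]) simp_all
  qed
  moreover have "inj_on ?f (Pow (upper_pairs n))"
    by (intro inj_on_image) (auto simp: inj_on_def)
  moreover have "finite (states ?N)"
    by (simp add: states_cluster_nfa C relation_automaton_def)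
  then have "finite (states ?O)" by (simp add: states_observer)
  ultimately have "card (Pow (upper_pairs n)) \<le> card (states ?O)"
    by (metis card_image card_mono)
  then show ?thesis by (simp add: card_Pow finite_upper_pairs card_upper_pairs)
qed

text \<open>With no secret pairs nothing violates opacity, so Algorithm 1 must process the whole
  semigroup. For Algorithm 2 the observer alone reaches the bound.\<close>

lemma relation_automaton_lower_bounds:
  defines "QNS \<equiv> {..<n} \<times> {..<n}"
  shows "ifo_input A (events A) {} QNS"
    and "generation_order A (events A) Ms \<Longrightarrow> \<forall>M \<in> set Ms. 1 \<le> c M \<Longrightarrow>
      2 ^ (n * (n + 1) div 2) \<le> snd (algorithm1 c {} QNS Ms)"
    and "2 ^ (n * (n + 1) div 2) \<le> snd (algorithm2 A (events A) (cluster {}) (cluster QNS))"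
proof -
  show "ifo_input A (events A) {} QNS"
    using wf_relation_automaton by (auto simp: ifo_input_def QNS_def relation_automaton_def)
  show "2 ^ (n * (n + 1) div 2) \<le> snd (algorithm1 c {} QNS Ms)"
    if "generation_order A (events A) Ms" "\<forall>M \<in> set Ms. 1 \<le> c M"
  proof -
    have "2 ^ (n * (n + 1) div 2) \<le> length Ms"
      using generation_order_length[OF that(1)] card_matrix_semigroup_relation_automaton
      by (simp add: project_all_observable)
    also have "\<dots> \<le> snd (algorithm1 c {} QNS Ms)"
      using that(2) by (intro algorithm1_steps_ge) (auto simp: violates_def)
    finally show ?thesis .
  qed
  show "2 ^ (n * (n + 1) div 2) \<le> snd (algorithm2 A (events A) (cluster {}) (cluster QNS))"
    using card_observer_relation_automaton by (simp add: algorithm2_def Let_def QNS_def)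
qed

end

section \<open>Asymptotic bounds and tightness\<close>

lemma ex_relation_enumeration:
  "\<exists>h. bij_betw h {..<2 ^ (n * (n + 1) div 2) :: nat} (Pow (upper_pairs n))"
  using ex_bij_betw_nat_finite[of "Pow (upper_pairs n)"]
  by (simp add: card_Pow finite_upper_pairs card_upper_pairs atLeast0LessThan)

lemma poly_times_in_O_star: "(\<lambda>n. g n * poly p (real n)) \<in> O_star g"
  unfolding O_star_def by (auto intro!: exI[of _ p])

text \<open>The bound \<open>T\<close> is fixed before the automaton, so it is uniform over all
  inputs; for Algorithm 1 it may depend only on the constant \<open>K\<close> of the quadratic scan.
  The lower bound for Algorithm 1 covers every generation order and every cost of at least one step
  per element.\<close>

theorem theorem10:
  "(\<forall>K :: nat. \<exists>T \<in> O_star (\<lambda>n. 2 ^ (n * (n + 1) div 2)).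
      \<forall>(A :: ('q, 'e) automaton) So QS QNS Ms c.
        ifo_input A So QS QNS \<and> partially_ordered A \<and> generation_order A So Ms \<and>
        (\<forall>M \<in> set Ms. c M \<le> K * card (states A) ^ 2) \<longrightarrow>
        real (snd (algorithm1 c QS QNS Ms)) \<le> T (card (states A))) \<and>
   (\<exists>T \<in> O_star (\<lambda>n. 2 ^ (n * (n + 1) div 2)).
      \<forall>(A :: ('q, 'e) automaton) So QS QNS.
        ifo_input A So QS QNS \<and> partially_ordered A \<longrightarrow>
        real (snd (algorithm2 A So (cluster QS) (cluster QNS))) \<le> T (card (states A))) \<and>
   (\<forall>n \<ge> 1. \<exists>(A :: (nat, nat) automaton) So QS QNS.
      ifo_input A So QS QNS \<and> partially_ordered A \<and> card (states A) = n \<and>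
      (\<forall>Ms c. generation_order A So Ms \<and> (\<forall>M \<in> set Ms. 1 \<le> c M) \<longrightarrow>
         2 ^ (n * (n + 1) div 2) \<le> snd (algorithm1 c QS QNS Ms)) \<and>
      2 ^ (n * (n + 1) div 2) \<le> snd (algorithm2 A So (cluster QS) (cluster QNS)))"
proof (intro conjI allI impI)
  let ?g = "\<lambda>n :: nat. 2 ^ (n * (n + 1) div 2) :: real"
  fix K :: nat
  \<comment> \<open>The polynomial is K n^2, the allowed cost of one element.\<close>
  let ?T = "\<lambda>n. ?g n * poly [:0, 0, real K:] (real n)"
  have "real (snd (algorithm1 c QS QNS Ms)) \<le> ?T (card (states A))"
    if "ifo_input A So QS QNS" "partially_ordered A" "generation_order A So Ms"
      "\<forall>M \<in> set Ms. c M \<le> K * card (states A) ^ 2"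
    for A :: "('q, 'e) automaton" and So QS QNS Ms c
    using of_nat_mono[OF algorithm1_upper_bound[OF that], where 'a = real]
    by (simp add: power2_eq_square mult_ac)
  then show "\<exists>T \<in> O_star ?g. \<forall>(A :: ('q, 'e) automaton) So QS QNS Ms c.
      ifo_input A So QS QNS \<and> partially_ordered A \<and> generation_order A So Ms \<and>
      (\<forall>M \<in> set Ms. c M \<le> K * card (states A) ^ 2) \<longrightarrow>
      real (snd (algorithm1 c QS QNS Ms)) \<le> T (card (states A))"
    by (intro bexI[OF _ poly_times_in_O_star]) blast
next
  let ?g = "\<lambda>n :: nat. 2 ^ (n * (n + 1) div 2) :: real"
  \<comment> \<open>The polynomial is 1 + n^2, the factor from
    \<open>algorithm2_upper_bound\<close>.\<close>
  let ?T = "\<lambda>n. ?g n * poly [:1, 0, 1:] (real n)"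
  have "real (snd (algorithm2 A So (cluster QS) (cluster QNS))) \<le> ?T (card (states A))"
    if "ifo_input A So QS QNS" "partially_ordered A"
    for A :: "('q, 'e) automaton" and So QS QNS
    using of_nat_mono[OF algorithm2_upper_bound[OF that], where 'a = real]
    by (simp add: power2_eq_square algebra_simps)
  then show "\<exists>T \<in> O_star ?g. \<forall>(A :: ('q, 'e) automaton) So QS QNS.
      ifo_input A So QS QNS \<and> partially_ordered A \<longrightarrow>
      real (snd (algorithm2 A So (cluster QS) (cluster QNS))) \<le> T (card (states A))"
    by (intro bexI[OF _ poly_times_in_O_star]) blast
next
  fix n :: nat
  obtain h where h: "bij_betw h {..<2 ^ (n * (n + 1) div 2) :: nat} (Pow (upper_pairs n))"
    using ex_relation_enumeration by blast
  let ?A = "relation_automaton n h"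
  have "card (states ?A) = n" by (simp add: relation_automaton_def)
  then show "\<exists>(A :: (nat, nat) automaton) So QS QNS.
      ifo_input A So QS QNS \<and> partially_ordered A \<and> card (states A) = n \<and>
      (\<forall>Ms c. generation_order A So Ms \<and> (\<forall>M \<in> set Ms. 1 \<le> c M) \<longrightarrow>
         2 ^ (n * (n + 1) div 2) \<le> snd (algorithm1 c QS QNS Ms)) \<and>
      2 ^ (n * (n + 1) div 2) \<le> snd (algorithm2 A So (cluster QS) (cluster QNS))"
    using relation_automaton_lower_bounds[OF h] partially_ordered_relation_automaton[OF h]
    by blast
qed

end
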